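(* Let $N \geq 3$, let $a_1, \ldots, a_N > 0$, and let $$\Omega = \Big\{ x \in \mathbb{R}^N : \sum_{i=1}^N \frac{x_i^2}{a_i^2} \leq 1 \Big\}$$ be the ellipsoidal domain of $\mathbb{R}^N$ with semi-axes lengths $a_1, \ldots, a_N$. Then for every $x \in \mathbb{R}^N$, $$\mathcal{N}_{\Omega}[1_{\Omega}](x) = \frac{1}{4} \int_{\tau(x)}^{+\infty} \gamma_t \, (1 - A_t x \cdot x) \, \mathrm{d}t, \qquad \gamma_t := \prod_{i=1}^N \frac{a_i}{\sqrt{a_i^2 + t}},$$ where $\mathcal{N}_\Omega[1_\Omega]$ is the Newtonian potential of $\Omega$, $A_t$ is the diagonal matrix with entries $1/(a_i^2+t)$, and $\tau : \mathbb{R}^N \to [0,+\infty)$ is the function with $\tau(x) = 0$ if $x \in \overline{\Omega}$ and, if $x \in \Omega^c = \mathbb{R}^N \setminus \Omega$, $\tau(x)$ is the non-negative number such that $x \in \partial \Omega_{\tau(x)}$.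
   Context: For $t \in [0,+\infty)$, $A_t := \mathrm{diag}\left[ \frac{1}{a_1^2+t}, \ldots, \frac{1}{a_N^2+t} \right]$, and $\Omega_t := \{ x \in \mathbb{R}^N : A_t x \cdot x \leq 1 \}$, where $\cdot$ is the Euclidean inner product; thus $\Omega_0 = \Omega$ and $\partial\Omega_t = \{ x \in \mathbb{R}^N : A_t x \cdot x = 1\}$. For $x \notin \Omega$, $\tau(x)$ is therefore the solution $t \geq 0$ of $\sum_{i=1}^N \frac{x_i^2}{a_i^2+t} = 1$. The Newtonian potential generated by the uniform unit density on $\Omega$ is $$\mathcal{N}_{\Omega}[1_{\Omega}](x) := c_N \int_{\Omega} \frac{1}{|x-y|^{N-2}} \, \mathrm{d}y, \qquad c_N := \frac{1}{(N-2)\,\omega_N},$$ where $\omega_N$ is the surface measure of the unit sphere in $\mathbb{R}^N$, $|\cdot|$ is the Euclidean norm, and $\mathrm{d}y$ is Lebesgue measure. *)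

theory Defs
  imports "HOL-Analysis.Analysis"
begin

text \<open>
  Surface measure of a compact smooth hypersurface \<open>S\<close>, as the limit of the volume of the
  tube of radius \<open>\<epsilon>\<close> around \<open>S\<close> divided by its thickness \<open>2\<epsilon>\<close>, i.e. the codimension one
  Minkowski content. On such hypersurfaces it agrees with the Riemannian surface measure and
  the Hausdorff measure, neither of which is available in the library. The lemma
  \<open>surface_area_unit_sphere\<close> below shows that the limit exists for the unit sphere and has the
  expected value.
\<close>
definition surface_area :: "'a::euclidean_space set \<Rightarrow> real" where
  "surface_area S =
     Lim (at_right 0) (\<lambda>\<epsilon>. measure lborel (\<Union>y\<in>S. ball y \<epsilon>) / (2 * \<epsilon>))"

definition newton_const :: "'n::finite itself \<Rightarrow> real" where
  "newton_const _ =
     1 / ((real CARD('n) - 2) * surface_area (sphere (0 :: real^'n) 1))"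

definition newtonian_potential ::
    "(real^'n::finite) set \<Rightarrow> (real^'n \<Rightarrow> real) \<Rightarrow> real^'n \<Rightarrow> real" where
  "newtonian_potential D f x =
     newton_const TYPE('n) * (LINT y:D|lborel. 1 / norm (x - y) ^ (CARD('n) - 2) * f y)"

definition ellipsoid :: "real^'n::finite \<Rightarrow> (real^'n) set" where
  "ellipsoid a = {x. (\<Sum>i\<in>UNIV. (x $ i)^2 / (a $ i)^2) \<le> 1}"

definition A_mat :: "real^'n::finite \<Rightarrow> real \<Rightarrow> real^'n^'n" where
  "A_mat a t = (\<chi> i j. if i = j then 1 / ((a $ i)^2 + t) else 0)"

definition ellipsoid_at :: "real^'n::finite \<Rightarrow> real \<Rightarrow> (real^'n) set" where
  "ellipsoid_at a t = {x. (A_mat a t *v x) \<bullet> x \<le> 1}"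

definition tau :: "real^'n::finite \<Rightarrow> real^'n \<Rightarrow> real" where
  "tau a x = (if x \<in> closure (ellipsoid a) then 0
              else (THE t. t \<ge> 0 \<and> x \<in> frontier (ellipsoid_at a t)))"

definition gamma_prod :: "real^'n::finite \<Rightarrow> real \<Rightarrow> real" where
  "gamma_prod a t = (\<Prod>i\<in>UNIV. a $ i / sqrt ((a $ i)^2 + t))"

lemma surface_area_unit_sphere:
  "surface_area (sphere (0 :: 'a::euclidean_space) 1) = real DIM('a) * unit_ball_vol (real DIM('a))"
proof -
  define n where "n = DIM('a)"
  define B where "B = unit_ball_vol (real n)"
  have vol: "measure lborel (\<Union>y\<in>sphere (0::'a) 1. ball y \<epsilon>) = B * ((1 + \<epsilon>)^n - (1 - \<epsilon>)^n)"
    if e: "0 < \<epsilon>" "\<epsilon> < 1" for \<epsilon>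
  proof -
    have "(\<Union>y\<in>sphere (0::'a) 1. ball y \<epsilon>) = ball 0 (1 + \<epsilon>) - cball 0 (1 - \<epsilon>)"
    proof (intro equalityI subsetI)
      fix x :: 'a assume "x \<in> (\<Union>y\<in>sphere (0::'a) 1. ball y \<epsilon>)"
      then obtain y where y: "norm y = 1" "dist y x < \<epsilon>" by auto
      have "norm x \<le> norm y + dist y x" "norm y \<le> norm x + dist y x"
        by (metis dist_0_norm dist_triangle dist_commute)
           (metis dist_0_norm dist_triangle dist_commute)
      with y show "x \<in> ball 0 (1 + \<epsilon>) - cball 0 (1 - \<epsilon>)" by auto
    next
      fix x :: 'a assume x: "x \<in> ball 0 (1 + \<epsilon>) - cball 0 (1 - \<epsilon>)"
      then have nx: "norm x < 1 + \<epsilon>" "norm x > 1 - \<epsilon>" by auto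
      then have x0: "x \<noteq> 0" using e by auto
      have "sgn x - x = (1 / norm x - 1) *\<^sub>R x"
        by (simp add: sgn_div_norm divide_inverse scaleR_diff_left)
      then have "dist (sgn x) x = \<bar>1 / norm x - 1\<bar> * norm x" by (simp add: dist_norm)
      also have "\<dots> = \<bar>(1 / norm x - 1) * norm x\<bar>" by (simp add: abs_mult)
      also have "(1 / norm x - 1) * norm x = 1 - norm x" using x0 by (simp add: left_diff_distrib)
      finally have "dist (sgn x) x < \<epsilon>" using nx by simp
      moreover have "norm (sgn x) = 1" using x0 by (simp add: norm_sgn)
      ultimately show "x \<in> (\<Union>y\<in>sphere (0::'a) 1. ball y \<epsilon>)" by auto
    qed
    moreover have "measure lborel (ball (0::'a) (1 + \<epsilon>) - cball 0 (1 - \<epsilon>))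
        = measure lborel (ball (0::'a) (1 + \<epsilon>)) - measure lborel (cball (0::'a) (1 - \<epsilon>))"
      using e emeasure_lborel_ball_finite[of "0::'a" "1 + \<epsilon>"]
      by (intro measure_Diff) auto
    ultimately have "measure lborel (\<Union>y\<in>sphere (0::'a) 1. ball y \<epsilon>)
        = measure lborel (ball (0::'a) (1 + \<epsilon>)) - measure lborel (cball (0::'a) (1 - \<epsilon>))"
      by simp
    also have "\<dots> = B * ((1 + \<epsilon>)^n - (1 - \<epsilon>)^n)"
      using e content_ball[of "1 + \<epsilon>" "0::'a"] content_cball[of "1 - \<epsilon>" "0::'a"]
      by (simp add: B_def n_def right_diff_distrib)
    finally show ?thesis .
  qed
  have "((\<lambda>\<epsilon>::real. B * ((1 + \<epsilon>)^n - (1 - \<epsilon>)^n)) has_field_derivative B * (2 * real n)) (at 0)"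
    by (auto intro!: derivative_eq_intros)
  then have "((\<lambda>\<epsilon>. B * ((1 + \<epsilon>)^n - (1 - \<epsilon>)^n) / \<epsilon>) \<longlongrightarrow> B * (2 * real n)) (at 0)"
    by (simp add: has_field_derivative_iff)
  then have "((\<lambda>\<epsilon>. B * ((1 + \<epsilon>)^n - (1 - \<epsilon>)^n) / \<epsilon> / 2) \<longlongrightarrow> B * (2 * real n) / 2) (at_right 0)"
    by (intro tendsto_divide tendsto_const) (auto intro: tendsto_within_subset)
  then have lim: "((\<lambda>\<epsilon>. B * ((1 + \<epsilon>)^n - (1 - \<epsilon>)^n) / \<epsilon> / 2) \<longlongrightarrow> real n * B) (at_right 0)"
    by (simp add: mult.commute)
  have "eventually (\<lambda>\<epsilon>. B * ((1 + \<epsilon>)^n - (1 - \<epsilon>)^n) / \<epsilon> / 2 =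
        measure lborel (\<Union>y\<in>sphere (0::'a) 1. ball y \<epsilon>) / (2 * \<epsilon>)) (at_right (0::real))"
    using eventually_at_right_real[OF zero_less_one] by (rule eventually_mono) (auto simp: vol)
  with lim have "((\<lambda>\<epsilon>. measure lborel (\<Union>y\<in>sphere (0::'a) 1. ball y \<epsilon>) / (2 * \<epsilon>))
      \<longlongrightarrow> real n * B) (at_right 0)"
    by (rule Lim_transform_eventually)
  then show ?thesis
    unfolding surface_area_def n_def B_def by (intro tendsto_Lim) auto
qed

end

theory Submission
  imports Defs "HOL-Probability.Distributions" "HOL-Real_Asymp.Real_Asymp"
begin

text \<open>
  Write \<open>q y = A_0 y \<cdot> y\<close> and consider, for a density \<open>f (q y)\<close>, the more general identity
  \<open>N[f (q)](x) = 1/4 \<integral> \<gamma>_t F (A_t x \<cdot> x) dt\<close> over \<open>t > 0\<close>, where \<open>F r\<close> is the integral of \<open>f\<close> over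
  \<open>[r, \<infinity>)\<close>. For \<open>f r = exp (- \<lambda> r)\<close> it is a Gaussian computation: writing the Newtonian kernel
  as a superposition of the Gaussians \<open>exp (- (\<lambda> / t) |x - y|\<^sup>2)\<close>, the integral over \<open>y\<close> factors
  and equals \<open>\<gamma>_t exp (- \<lambda> A_t x \<cdot> x)\<close> up to a power of \<open>t\<close>. Both sides of the identity are
  integrals of \<open>f\<close> against measures on \<open>[0, \<infinity>)\<close>, and these have the same Laplace transform; by the
  determinacy of the moment problem on \<open>[0, 1]\<close> they coincide. The indicator \<open>f\<close> of \<open>[0, 1]\<close> gives
  \<open>F r = max 0 (1 - r)\<close>, and \<open>1 - A_t x \<cdot> x\<close> changes sign at \<open>t = \<tau> x\<close>.
\<close>

section \<open>Determinacy of the moment problem on a compact interval\<close>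

text \<open>Equal moments give equal integrals of polynomials, hence by Weierstrass approximation on
  \<open>{c..d}\<close> of all continuous functions; continuous ramps then approximate indicators of
  open half-lines, which determine a finite measure. The support condition is only almost
  everywhere, as suits push-forwards that live formally on the whole line.\<close>

lemma finite_measure_eqI_moments:
  fixes M N :: "real measure"
  assumes "finite_measure M" "finite_measure N"
    and sets: "sets M = sets borel" "sets N = sets borel"
    and supp: "AE x in M. x \<in> {c..d}" "AE x in N. x \<in> {c..d}"
    and moments: "\<And>n. (LINT x|M. x ^ n) = (LINT x|N. x ^ n)"
  shows "M = N"
proof -
  interpret M: finite_measure M by fact
  interpret N: finite_measure N by fact
  have meas: "f \<in> borel_measurable M" "f \<in> borel_measurable N"
    if "continuous_on UNIV f" for f :: "real \<Rightarrow> real"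
    using borel_measurable_continuous_onI[OF that] sets by (simp_all cong: measurable_cong_sets)
  have int: "integrable M f" "integrable N f" if f: "continuous_on UNIV f" for f :: "real \<Rightarrow> real"
  proof -
    have "compact (f ` {c..d})"
      by (intro compact_continuous_image continuous_on_subset[OF f]) auto
    then obtain B where B: "\<And>x. x \<in> {c..d} \<Longrightarrow> norm (f x) \<le> B"
      by (meson bounded_iff compact_imp_bounded imageI)
    show "integrable M f"
      by (intro M.integrable_const_bound[where B=B] eventually_mono[OF supp(1)] B meas f)
    show "integrable N f"
      by (intro N.integrable_const_bound[where B=B] eventually_mono[OF supp(2)] B meas f)
  qed
  have poly: "(LINT x|M. p x) = (LINT x|N. p x)" if "real_polynomial_function p" for p :: "real \<Rightarrow> real"
  proof -
    have "\<exists>a n. p = (\<lambda>x. \<Sum>i\<le>n. a i * x ^ i)"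
      using that by (simp only: real_polynomial_function_iff_sum)
    then obtain a n where p: "p = (\<lambda>x. \<Sum>i\<le>n. a i * x ^ i)"
      by blast
    have "integrable M (\<lambda>x. a i * x ^ i)" "integrable N (\<lambda>x. a i * x ^ i)" for i
      by (rule int; intro continuous_intros)+
    then show ?thesis
      unfolding p by (simp add: moments)
  qed
  have cont: "(LINT x|M. f x) = (LINT x|N. f x)" if f: "continuous_on UNIV f" for f :: "real \<Rightarrow> real"
  proof (rule ccontr)
    define D where "D = \<bar>(LINT x|M. f x) - (LINT x|N. f x)\<bar>"
    \<comment> \<open>Approximating \<open>f\<close> within \<open>D / K\<close> on
      \<open>{c..d}\<close> costs at most \<open>D / K\<close> times the total mass
      \<open>K - 1\<close> of both measures. The added 1 makes this strictly less than
      \<open>D\<close> and keeps \<open>K\<close> positive even for null measures.\<close>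
    define K where "K = measure M (space M) + measure N (space N) + 1"
    assume "\<not> ?thesis"
    then have D: "D > 0" by (simp add: D_def)
    have K: "K > 0" by (simp add: K_def add_nonneg_pos)
    obtain p where p: "real_polynomial_function p" "\<And>x. x \<in> {c..d} \<Longrightarrow> \<bar>f x - p x\<bar> < D / K"
      using Stone_Weierstrass_real_polynomial_function[of "{c..d}" f "D / K"]
        continuous_on_subset[OF f] D K by (metis compact_Icc subset_UNIV divide_pos_pos)
    have pc: "continuous_on UNIV p"
      using p(1) continuous_on_polymonial_function real_polynomial_function_eq by blast
    have "\<bar>(LINT x|M. f x) - (LINT x|M. p x)\<bar> \<le> D / K * measure M (space M)"
    proof -
      have "\<bar>LINT x|M. f x - p x\<bar> \<le> (LINT x|M. \<bar>f x - p x\<bar>)" by (rule integral_abs_bound)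
      also have "\<dots> \<le> (LINT x|M. D / K)"
        by (intro integral_mono_AE int eventually_mono[OF supp(1)] less_imp_le[OF p(2)]
            continuous_intros f pc)
      finally show ?thesis using int[OF f] int[OF pc] by (simp add: mult.commute)
    qed
    moreover have "\<bar>(LINT x|N. f x) - (LINT x|N. p x)\<bar> \<le> D / K * measure N (space N)"
    proof -
      have "\<bar>LINT x|N. f x - p x\<bar> \<le> (LINT x|N. \<bar>f x - p x\<bar>)" by (rule integral_abs_bound)
      also have "\<dots> \<le> (LINT x|N. D / K)"
        by (intro integral_mono_AE int eventually_mono[OF supp(2)] less_imp_le[OF p(2)]
            continuous_intros f pc)
      finally show ?thesis using int[OF f] int[OF pc] by (simp add: mult.commute)
    qed
    ultimately have "D \<le> D / K * (K - 1)"
      using poly[OF p(1)] unfolding D_def K_def by (simp add: distrib_left)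
    also have "\<dots> < D" using D K by (simp add: field_simps)
    finally show False by simp
  qed
  show ?thesis
  proof (rule measure_eqI_lessThan[OF sets])
    fix z :: real
    show "emeasure M {z<..} < \<infinity>"
      unfolding infinity_ennreal_def less_top[symmetric] by (rule M.emeasure_finite)
    \<comment> \<open>For \<open>n > 0\<close> this ramp is 0 up to \<open>z\<close> and 1 from
      \<open>z + 1 / n\<close> on. It vanishes at \<open>z\<close> itself, so the limit is the
      indicator of the open half-line.\<close>
    define f where "f n x = min 1 (max 0 (real n * (x - z)))" for n x
    have fc: "continuous_on UNIV (f n)" for n
      unfolding f_def by (intro continuous_intros)
    have f_bound: "\<bar>f n x\<bar> \<le> 1" for n x by (simp add: f_def)
    have lim: "(\<lambda>n. f n x) \<longlonglongrightarrow> indicator {z<..} x" for x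
    proof (cases "x > z")
      case True
      have "\<forall>\<^sub>F n in sequentially. f n x = 1"
        using eventually_ge_at_top[of "nat \<lceil>1 / (x - z)\<rceil>"]
      proof eventually_elim
        case (elim n)
        then have "1 / (x - z) \<le> real n" by linarith
        then have "1 \<le> real n * (x - z)" using True by (simp add: field_simps)
        then show ?case by (simp add: f_def)
      qed
      with True show ?thesis by (simp add: tendsto_eventually)
    next
      case False
      then have "f n x = 0" for n by (simp add: f_def mult_nonneg_nonpos)
      with False show ?thesis by simp
    qed
    have "(\<lambda>n. LINT x|M. f n x) \<longlonglongrightarrow> (LINT x|M. indicator {z<..} x)"
      by (rule integral_dominated_convergence[where w="\<lambda>_. 1"])
        (auto simp: sets f_bound intro!: meas fc lim borel_measurable_indicator)
    moreover have "(\<lambda>n. LINT x|N. f n x) \<longlonglongrightarrow> (LINT x|N. indicator {z<..} x)"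
      by (rule integral_dominated_convergence[where w="\<lambda>_. 1"])
        (auto simp: sets f_bound intro!: meas fc lim borel_measurable_indicator)
    ultimately have "(LINT x|M. indicator {z<..} x) = (LINT x|N. indicator {z<..} x :: real)"
      unfolding cont[OF fc] by (rule LIMSEQ_unique)
    moreover have "space M = UNIV" "space N = UNIV"
      using sets by (auto dest: sets_eq_imp_space_eq)
    ultimately show "emeasure M {z<..} = emeasure N {z<..}"
      by (simp add: M.emeasure_eq_measure N.emeasure_eq_measure)
  qed
qed

section \<open>One-dimensional Gamma and Gaussian integrals\<close>

text \<open>The substitution of \<open>c / t\<close> for \<open>t\<close>, a bijection of the open
  half-line, turns Euler's integral for \<open>Gamma p\<close> into this one. With \<open>c\<close>
  proportional to the squared distance it expresses a negative power of the distance as a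
  superposition of Gaussians.\<close>

lemma nn_integral_inverse_Gamma:
  assumes p: "p > 0" and c: "c > 0"
  shows "(\<integral>\<^sup>+t. ennreal (indicator {0<..} t * (t powr (- p - 1) * exp (- c / t))) \<partial>lborel)
    = ennreal (Gamma p * c powr (- p))"
proof -
  define f where "f t = t powr (p - 1) / exp t" for t :: real
  have f_int: "(f has_integral Gamma p) {0<..}"
  proof -
    have "(f has_integral Gamma p) {0..}"
      unfolding f_def by (rule Gamma_integral_real[OF p])
    then show ?thesis
      by (subst has_integral_spike_set_eq[where S="{0<..}" and T="{0..}"])
        (auto intro: negligible_subset[of "{0}"] simp: not_less)
  qed
  have f_abs: "f absolutely_integrable_on {0<..}"
    using f_int by (intro nonnegative_absolutely_integrable_1) (auto simp: f_def integrable_on_def)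
  have img: "(\<lambda>t::real. c / t) ` {0<..} = {0<..}"
  proof (intro equalityI subsetI)
    fix t :: real assume "t \<in> {0<..}"
    then have "t = c / (c / t)" "c / t \<in> {0<..}" using c by auto
    then show "t \<in> (\<lambda>t. c / t) ` {0<..}" by blast
  qed (use c in auto)
  have der: "((\<lambda>t::real. c / t) has_field_derivative - c / t\<^sup>2) (at t within {0<..})" if "t \<in> {0<..}" for t :: real
    using that by (auto intro!: derivative_eq_intros simp: power2_eq_square)
  have inj: "inj_on (\<lambda>t::real. c / t) {0<..}" using c by (auto simp: inj_on_def)
  have "(\<lambda>t. \<bar>- c / t\<^sup>2\<bar> * f (c / t)) absolutely_integrable_on {0<..} \<and>
      integral {0<..} (\<lambda>t. \<bar>- c / t\<^sup>2\<bar> * f (c / t)) = Gamma p"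
    using has_absolute_integral_change_of_variables_1'[OF _ der inj, of f "Gamma p"] f_abs f_int
    by (simp add: img integral_unique)
  then have "((\<lambda>t. \<bar>- c / t\<^sup>2\<bar> * f (c / t)) has_integral Gamma p) {0<..}"
    using absolutely_integrable_on_def has_integral_integrable_integral by blast
  then have "((\<lambda>t. c powr p * (t powr (- p - 1) * exp (- c / t))) has_integral Gamma p) {0<..}"
  proof (rule has_integral_eq[rotated])
    fix t :: real assume t: "t \<in> {0<..}"
    have "\<bar>- c / t\<^sup>2\<bar> * f (c / t) = (c * c powr (p - 1)) * (t powr (- 2) * t powr (- (p - 1))) * exp (- c / t)"
      using t c by (simp add: f_def powr_divide powr_minus exp_minus field_simps powr_numeral)
        (simp add: powr_add[symmetric])
    also have "c * c powr (p - 1) = c powr p" using c by (simp add: powr_mult_base)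
    also have "t powr (- 2) * t powr (- (p - 1)) = t powr (- p - 1)"
      by (simp add: minus_diff_commute flip: powr_add)
    finally show "\<bar>- c / t\<^sup>2\<bar> * f (c / t) = c powr p * (t powr (- p - 1) * exp (- c / t))" by simp
  qed
  note has_integral_mult_left[OF this, of "c powr (- p)"]
  moreover have "c powr p * z * c powr (- p) = z" for z :: real
    using c by (simp add: powr_minus)
  ultimately have "((\<lambda>t. t powr (- p - 1) * exp (- c / t)) has_integral (Gamma p * c powr (- p))) {0<..}"
    by (simp only:)
  from nn_integral_has_integral_lebesgue[OF _ this] show ?thesis by simp
qed

text \<open>Completing the square in \<open>y\<close> leaves the constant \<open>C\<close> times a
  normal density with mean \<open>\<mu>\<close> and variance
  \<open>1 / (2 * (\<alpha> + \<beta>))\<close>, whose total mass is 1.\<close>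

lemma nn_integral_gaussian_prod:
  fixes \<alpha> \<beta> x :: real
  assumes "\<alpha> > 0" "\<beta> > 0"
  shows "(\<integral>\<^sup>+y. ennreal (exp (- (\<alpha> * (x - y)\<^sup>2 + \<beta> * y\<^sup>2))) \<partial>lborel)
    = ennreal (sqrt (pi / (\<alpha> + \<beta>)) * exp (- (\<alpha> * \<beta> / (\<alpha> + \<beta>) * x\<^sup>2)))"
proof -
  define \<sigma> where "\<sigma> = sqrt (1 / (2 * (\<alpha> + \<beta>)))"
  define \<mu> where "\<mu> = \<alpha> * x / (\<alpha> + \<beta>)"
  have s: "\<sigma> > 0" "\<sigma>\<^sup>2 = 1 / (2 * (\<alpha> + \<beta>))" using assms by (simp_all add: \<sigma>_def)
  define C where "C = sqrt (pi / (\<alpha> + \<beta>)) * exp (- (\<alpha> * \<beta> / (\<alpha> + \<beta>) * x\<^sup>2))"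
  have "exp (- (\<alpha> * (x - y)\<^sup>2 + \<beta> * y\<^sup>2)) = C * normal_density \<mu> \<sigma> y" for y
  proof -
    have "\<alpha> + \<beta> \<noteq> 0" using assms by simp
    then have "\<alpha> * (x - y)\<^sup>2 + \<beta> * y\<^sup>2 = \<alpha> * \<beta> / (\<alpha> + \<beta>) * x\<^sup>2 + (\<alpha> + \<beta>) * (y - \<mu>)\<^sup>2"
      unfolding \<mu>_def by (simp add: divide_simps) (simp add: power2_eq_square algebra_simps)
    moreover have "2 * pi * \<sigma>\<^sup>2 = pi / (\<alpha> + \<beta>)"
      using assms by (simp add: s(2) divide_simps)
    moreover have "(y - \<mu>)\<^sup>2 / (2 * \<sigma>\<^sup>2) = (\<alpha> + \<beta>) * (y - \<mu>)\<^sup>2"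
      using assms by (simp add: s(2) divide_divide_eq_right mult.commute)
    moreover have "sqrt (pi / (\<alpha> + \<beta>)) \<noteq> 0" using assms by simp
    ultimately show ?thesis
      unfolding C_def normal_density_def minus_divide_left[symmetric]
      by (simp del: real_sqrt_divide add: exp_add[symmetric])
  qed
  moreover have "(\<integral>\<^sup>+y. ennreal (normal_density \<mu> \<sigma> y) \<partial>lborel) = 1"
    using s by (simp add: nn_integral_eq_integral)
  moreover have "C \<ge> 0" using assms by (simp add: C_def)
  ultimately show ?thesis
    unfolding C_def[symmetric] by (simp add: ennreal_mult nn_integral_cmult)
qed

section \<open>The confocal quadratic forms and the identity for Gaussian densities\<close>

definition ellipsoid_form :: "real^'n::finite \<Rightarrow> real \<Rightarrow> real^'n \<Rightarrow> real" where
  "ellipsoid_form a t x = (\<Sum>i\<in>UNIV. (x $ i)\<^sup>2 / ((a $ i)\<^sup>2 + t))"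

lemma A_mat_inner: "(A_mat a t *v x) \<bullet> x = ellipsoid_form a t x"
  by (simp add: matrix_vector_mult_def A_mat_def inner_vec_def ellipsoid_form_def
      if_distrib[of "\<lambda>c. c * _"] power2_eq_square cong: if_cong)

lemma ellipsoid_conv_form: "ellipsoid a = {x. ellipsoid_form a 0 x \<le> 1}"
  by (simp add: ellipsoid_def ellipsoid_form_def)

lemma ellipsoid_form_nonneg: "t \<ge> 0 \<Longrightarrow> ellipsoid_form a t x \<ge> 0"
  by (simp add: ellipsoid_form_def sum_nonneg)

lemma continuous_on_ellipsoid_form: "continuous_on UNIV (ellipsoid_form a t)"
  unfolding ellipsoid_form_def divide_inverse by (intro continuous_intros)

lemma borel_measurable_ellipsoid_form [measurable]: "ellipsoid_form a t \<in> borel_measurable borel"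
  by (intro borel_measurable_continuous_onI continuous_on_ellipsoid_form)

lemma borel_measurable_ellipsoid_form' [measurable]:
  "(\<lambda>t. ellipsoid_form a t x) \<in> borel_measurable borel"
  unfolding ellipsoid_form_def by measurable

lemma borel_measurable_gamma_prod [measurable]: "gamma_prod a \<in> borel_measurable borel"
  unfolding gamma_prod_def by measurable

lemma gamma_prod_nonneg: "(\<And>i. a $ i > 0) \<Longrightarrow> t \<ge> 0 \<Longrightarrow> gamma_prod a t \<ge> 0"
  unfolding gamma_prod_def by (intro prod_nonneg) (simp add: less_imp_le)

text \<open>Product integration over \<open>lborel\<close> runs over \<open>Basis\<close>, whereas
  the forms and \<open>gamma_prod\<close> are indexed by coordinates.\<close>

lemma prod_Basis_vec: "(\<Prod>b\<in>Basis. f b) = (\<Prod>i\<in>UNIV. f (axis i 1))"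
  for f :: "real^'n::finite \<Rightarrow> 'a::comm_monoid_mult"
proof -
  have B: "Basis = range (\<lambda>i. axis i 1 :: real^'n)" by (auto simp: Basis_vec_def)
  show ?thesis unfolding B by (subst prod.reindex) (auto simp: inj_on_def axis_eq_axis)
qed

text \<open>The integrand factors over coordinates into one-dimensional Gaussians with \<alpha> = l
  / t and \<beta> = l / a_i^2. Then \<alpha> + \<beta> = l (a_i^2 + t) / (t a_i^2) supplies the
  factor of \<open>gamma_prod a t\<close>, and \<alpha> \<beta> / (\<alpha> + \<beta>) = l / (a_i^2
  + t) supplies l times the diagonal entry of A_t. This is where the confocal family arises.\<close>

lemma nn_integral_gaussian_ellipsoid_form:
  fixes a x :: "real^'n::finite"
  assumes a: "\<And>i. a $ i > 0" and l: "l > 0" and t: "t > 0"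
  shows "(\<integral>\<^sup>+y. ennreal (exp (- (l / t * (norm (x - y))\<^sup>2 + l * ellipsoid_form a 0 y))) \<partial>lborel)
    = ennreal ((pi * t / l) powr (real CARD('n) / 2) * gamma_prod a t * exp (- (l * ellipsoid_form a t x)))"
proof -
  define f where "f b u = exp (- (l / t * (x \<bullet> b - u)\<^sup>2 + l / (a \<bullet> b)\<^sup>2 * u\<^sup>2))" for b :: "real^'n" and u
  have "exp (- (l / t * (norm (x - y))\<^sup>2 + l * ellipsoid_form a 0 y)) = (\<Prod>b\<in>Basis. f b (y \<bullet> b))" for y
  proof -
    have "(norm (x - y))\<^sup>2 = (\<Sum>i\<in>UNIV. (x $ i - y $ i)\<^sup>2)"
      by (simp only: power2_norm_eq_inner inner_vec_def) (simp add: power2_eq_square)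
    then have "- (l / t * (norm (x - y))\<^sup>2 + l * ellipsoid_form a 0 y)
      = (\<Sum>i\<in>UNIV. - (l / t * (x $ i - y $ i)\<^sup>2 + l / (a $ i)\<^sup>2 * (y $ i)\<^sup>2))"
      by (simp add: ellipsoid_form_def sum.distrib sum_distrib_left sum_subtractf sum_negf)
    then show ?thesis
      by (simp add: f_def prod_Basis_vec inner_axis exp_sum)
  qed
  then have "(\<integral>\<^sup>+y. ennreal (exp (- (l / t * (norm (x - y))\<^sup>2 + l * ellipsoid_form a 0 y))) \<partial>lborel)
      = (\<integral>\<^sup>+y. (\<Prod>b\<in>Basis. ennreal (f b (y \<bullet> b))) \<partial>lborel)"
    by (simp add: prod_ennreal f_def)
  also have "\<dots> = (\<Prod>b\<in>Basis. (\<integral>\<^sup>+u. ennreal (f b u) \<partial>lborel))"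
    by (rule nn_integral_lborel_prod) (auto simp: f_def)
  also have "\<dots> = (\<Prod>i\<in>UNIV. ennreal (sqrt (pi * t / l) * (a $ i / sqrt ((a $ i)\<^sup>2 + t))
      * exp (- (l * ((x $ i)\<^sup>2 / ((a $ i)\<^sup>2 + t))))))"
    unfolding prod_Basis_vec
  proof (rule prod.cong[OF refl])
    fix i
    have ai: "a $ i > 0" by (rule a)
    have pos: "(a $ i)\<^sup>2 + t > 0" using ai t by (simp add: add_pos_pos)
    have den: "l / t + l / (a $ i)\<^sup>2 = l * ((a $ i)\<^sup>2 + t) / (t * (a $ i)\<^sup>2)"
      using ai t by (simp add: field_simps)
    have "pi / (l / t + l / (a $ i)\<^sup>2) = pi * t / l * ((a $ i)\<^sup>2 / ((a $ i)\<^sup>2 + t))"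
      unfolding den using ai t l pos by simp
    then have 1: "sqrt (pi / (l / t + l / (a $ i)\<^sup>2)) = sqrt (pi * t / l) * (a $ i / sqrt ((a $ i)\<^sup>2 + t))"
      using ai by (simp only: real_sqrt_mult real_sqrt_divide) simp
    have 2: "l / t * (l / (a $ i)\<^sup>2) / (l / t + l / (a $ i)\<^sup>2) * (x $ i)\<^sup>2
        = l * ((x $ i)\<^sup>2 / ((a $ i)\<^sup>2 + t))"
      unfolding den using ai t l pos by simp
    have "(\<integral>\<^sup>+u. ennreal (f (axis i 1) u) \<partial>lborel)
        = (\<integral>\<^sup>+u. ennreal (exp (- (l / t * (x $ i - u)\<^sup>2 + l / (a $ i)\<^sup>2 * u\<^sup>2))) \<partial>lborel)"
      by (simp add: f_def inner_axis)
    also have "\<dots> = ennreal (sqrt (pi / (l / t + l / (a $ i)\<^sup>2)) *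
        exp (- (l / t * (l / (a $ i)\<^sup>2) / (l / t + l / (a $ i)\<^sup>2) * (x $ i)\<^sup>2)))"
      by (rule nn_integral_gaussian_prod) (use l t ai in auto)
    finally show "(\<integral>\<^sup>+u. ennreal (f (axis i 1) u) \<partial>lborel) = ennreal (sqrt (pi * t / l)
        * (a $ i / sqrt ((a $ i)\<^sup>2 + t)) * exp (- (l * ((x $ i)\<^sup>2 / ((a $ i)\<^sup>2 + t)))))"
      unfolding 1 2 .
  qed
  also have "\<dots> = ennreal (\<Prod>i\<in>UNIV. sqrt (pi * t / l) * (a $ i / sqrt ((a $ i)\<^sup>2 + t))
      * exp (- (l * ((x $ i)\<^sup>2 / ((a $ i)\<^sup>2 + t)))))"
    by (rule prod_ennreal) (use a l t in \<open>simp add: less_imp_le\<close>)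
  also have "(\<Prod>i\<in>UNIV. sqrt (pi * t / l) * (a $ i / sqrt ((a $ i)\<^sup>2 + t))
      * exp (- (l * ((x $ i)\<^sup>2 / ((a $ i)\<^sup>2 + t)))))
      = sqrt (pi * t / l) ^ CARD('n) * gamma_prod a t * exp (- (l * ellipsoid_form a t x))"
    by (simp only: prod.distrib prod_constant gamma_prod_def)
      (simp add: ellipsoid_form_def exp_sum sum_distrib_left flip: sum_negf)
  also have "sqrt (pi * t / l) ^ CARD('n) = (pi * t / l) powr (real CARD('n) / 2)"
    using l t by (simp add: powr_half_sqrt[symmetric] powr_power del: real_sqrt_divide)
  finally show ?thesis .
qed

text \<open>The Newton kernel is replaced by its superposition of Gaussians, and Tonelli's theorem
  allows the integral over \<open>y\<close> to be taken first. On the right, exp (- l r) / l is the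
  integral of exp (- l s) over s \<ge> r, evaluated at the form.\<close>

lemma nn_integral_newton_gaussian:
  fixes a x :: "real^'n::finite"
  assumes N: "CARD('n) \<ge> 3" and a: "\<And>i. a $ i > 0" and l: "l > 0"
  shows "(\<integral>\<^sup>+y. ennreal (1 / norm (x - y) ^ (CARD('n) - 2) * exp (- (l * ellipsoid_form a 0 y))) \<partial>lborel)
    = (\<integral>\<^sup>+t. ennreal (indicator {0<..} t * (pi powr (real CARD('n) / 2) / Gamma (real CARD('n) / 2 - 1)
        * gamma_prod a t * exp (- (l * ellipsoid_form a t x)) / l)) \<partial>lborel)"
proof -
  define p where "p = real CARD('n) / 2 - 1"
  have p: "p > 0" using N by (simp add: p_def)
  \<comment> \<open>Normalizes the superposition: with \<open>c = l * r^2\<close> the inverse Gamma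
    integral gives \<open>Gamma p * l powr (- p)\<close> divided by
    \<open>r ^ (CARD('n) - 2)\<close>, because \<open>2 * p = CARD('n) - 2\<close>.\<close>
  define K where "K = l powr p / Gamma p"
  have K: "K > 0" using p l by (simp add: K_def Gamma_real_pos)
  define h where "h t y = K * t powr (- p - 1) * exp (- (l / t * (norm (x - y))\<^sup>2 + l * ellipsoid_form a 0 y))"
    for t :: real and y
  have "(\<integral>\<^sup>+y. ennreal (1 / norm (x - y) ^ (CARD('n) - 2) * exp (- (l * ellipsoid_form a 0 y))) \<partial>lborel)
    = (\<integral>\<^sup>+y. \<integral>\<^sup>+t. ennreal (indicator {0<..} t * h t y) \<partial>lborel \<partial>lborel)"
  \<comment> \<open>The point \<open>y = x\<close> must be left out: there the left integrand is 0,
    as a division by zero, while the integral over \<open>t\<close> diverges.\<close>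
  proof (rule nn_integral_cong_AE, rule eventually_mono[OF AE_lborel_singleton[of x]])
    fix y assume "y \<noteq> x"
    define r where "r = norm (x - y)"
    define E where "E = exp (- (l * ellipsoid_form a 0 y))"
    have r: "r > 0" using \<open>y \<noteq> x\<close> by (simp add: r_def)
    have "h t y = K * E * (t powr (- p - 1) * exp (- (l * r\<^sup>2) / t))" for t
      unfolding h_def E_def r_def minus_add_distrib exp_add by simp
    then have "(\<integral>\<^sup>+t. ennreal (indicator {0<..} t * h t y) \<partial>lborel)
      = (\<integral>\<^sup>+t. ennreal (K * E) * ennreal (indicator {0<..} t * (t powr (- p - 1) * exp (- (l * r\<^sup>2) / t))) \<partial>lborel)"
      using K by (intro nn_integral_cong) (simp add: E_def ennreal_mult[symmetric] mult_ac)
    also have "\<dots> = ennreal (K * E) * ennreal (Gamma p * (l * r\<^sup>2) powr (- p))"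
      using p l r nn_integral_inverse_Gamma[of p "l * r\<^sup>2"] by (subst nn_integral_cmult) simp_all
    also have "\<dots> = ennreal (K * E * (Gamma p * (l * r\<^sup>2) powr (- p)))"
      using K p by (simp add: ennreal_mult E_def Gamma_real_pos less_imp_le)
    also have "(l * r\<^sup>2) powr (- p) = l powr (- p) / r ^ (CARD('n) - 2)"
    proof -
      have "(r\<^sup>2) powr p = r powr (real (CARD('n) - 2))"
        using r N by (simp add: p_def powr_powr of_nat_diff flip: powr_numeral)
      also have "\<dots> = r ^ (CARD('n) - 2)" using r by (rule powr_realpow)
      finally show ?thesis using l r by (simp add: powr_mult powr_minus divide_simps)
    qed
    also have "K * E * (Gamma p * (l powr (- p) / r ^ (CARD('n) - 2))) = 1 / r ^ (CARD('n) - 2) * E"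
      using l Gamma_real_pos[OF p] by (simp add: K_def powr_minus divide_simps)
    finally show "ennreal (1 / norm (x - y) ^ (CARD('n) - 2) * exp (- (l * ellipsoid_form a 0 y)))
      = (\<integral>\<^sup>+t. ennreal (indicator {0<..} t * h t y) \<partial>lborel)"
      unfolding r_def E_def by (rule sym)
  qed
  also have "\<dots> = (\<integral>\<^sup>+t. \<integral>\<^sup>+y. ennreal (indicator {0<..} t * h t y) \<partial>lborel \<partial>lborel)"
    unfolding h_def by (rule lborel_pair.Fubini') measurable
  also have "\<dots> = (\<integral>\<^sup>+t. ennreal (indicator {0<..} t * (pi powr (real CARD('n) / 2) / Gamma (real CARD('n) / 2 - 1)
        * gamma_prod a t * exp (- (l * ellipsoid_form a t x)) / l)) \<partial>lborel)"
  proof (rule nn_integral_cong)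
    fix t :: real
    show "(\<integral>\<^sup>+y. ennreal (indicator {0<..} t * h t y) \<partial>lborel)
      = ennreal (indicator {0<..} t * (pi powr (real CARD('n) / 2) / Gamma (real CARD('n) / 2 - 1)
        * gamma_prod a t * exp (- (l * ellipsoid_form a t x)) / l))"
    proof (cases "t > 0")
      case True
      define w where "w = gamma_prod a t * exp (- (l * ellipsoid_form a t x))"
      have w: "w \<ge> 0" unfolding w_def using True a by (simp add: gamma_prod_nonneg)
      have "(\<integral>\<^sup>+y. ennreal (indicator {0<..} t * h t y) \<partial>lborel)
        = (\<integral>\<^sup>+y. ennreal (K * t powr (- p - 1)) * ennreal (exp (- (l / t * (norm (x - y))\<^sup>2 + l * ellipsoid_form a 0 y))) \<partial>lborel)"
        using True K by (simp add: h_def ennreal_mult)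
      also have "\<dots> = ennreal (K * t powr (- p - 1)) * ennreal ((pi * t / l) powr (real CARD('n) / 2) * w)"
        by (subst nn_integral_cmult, measurable)
          (simp only: nn_integral_gaussian_ellipsoid_form[OF a l True] w_def mult.assoc)
      also have "\<dots> = ennreal (K * t powr (- p - 1) * ((pi * t / l) powr (real CARD('n) / 2) * w))"
        using K w by (intro ennreal_mult[symmetric]) auto
      also have "K * t powr (- p - 1) * ((pi * t / l) powr (real CARD('n) / 2) * w)
        = pi powr (real CARD('n) / 2) / Gamma p * w / l"
      proof -
        \<comment> \<open>The Gaussian integral contributes the power \<open>p + 1\<close> of
          \<open>t / l\<close>. Its power of \<open>t\<close> cancels the weight
          \<open>t powr (- p - 1)\<close>, and against the \<open>l powr p\<close> in
          \<open>K\<close> a single factor \<open>1 / l\<close> survives.\<close>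
        have q: "real CARD('n) / 2 = p + 1" by (simp add: p_def)
        have t1: "t powr (- p - 1) * t powr (p + 1) = 1"
          using True by (subst powr_add[symmetric]) simp
        have l1: "l powr (p + 1) = l powr p * l" using l by (simp add: powr_add)
        have "(pi * t / l) powr (p + 1) = pi powr (p + 1) * t powr (p + 1) / l powr (p + 1)"
          using True l by (simp add: powr_mult powr_divide)
        then have "K * t powr (- p - 1) * ((pi * t / l) powr (p + 1) * w)
          = (t powr (- p - 1) * t powr (p + 1)) * (pi powr (p + 1) / Gamma p * w / l)"
          unfolding K_def l1 using l by simp
        then show ?thesis unfolding q t1 by simp
      qed
      finally show ?thesis using True by (simp add: w_def p_def mult.assoc)
    qed simp
  qed
  finally show ?thesis .
qed

text \<open>Since a_i^2 \<le> m, every factor of \<open>gamma_prod a t\<close> is at most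
  \<open>1 / sqrt (1 + t / m)\<close>, which is at most 1. Dimension at least 3 therefore gives
  decay of order 3/2, enough for integrability at infinity.\<close>

lemma nn_integral_gamma_prod_finite:
  fixes a :: "real^'n::finite"
  assumes N: "CARD('n) \<ge> 3" and a: "\<And>i. a $ i > 0"
  shows "(\<integral>\<^sup>+t. ennreal (indicator {0<..} t * gamma_prod a t) \<partial>lborel) < \<infinity>"
proof -
  define m where "m = (\<Sum>i\<in>UNIV. (a $ i)\<^sup>2)"
  have m: "(a $ i)\<^sup>2 \<le> m" for i unfolding m_def by (rule member_le_sum) auto
  have m0: "m > 0" using m[of undefined] a[of undefined] by (smt (verit) zero_less_power)
  have bound: "gamma_prod a t \<le> (1 + t / m) powr (- 3 / 2)" if t: "t \<ge> 0" for t
  proof -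
    have "gamma_prod a t \<le> (\<Prod>i\<in>(UNIV :: 'n set). 1 / sqrt (1 + t / m))"
      unfolding gamma_prod_def
    proof (rule prod_mono, safe)
      fix i
      have ai: "a $ i > 0" by (rule a)
      show "0 \<le> a $ i / sqrt ((a $ i)\<^sup>2 + t)" using ai t by simp
      have "t / m \<le> t / (a $ i)\<^sup>2" using ai t m[of i] m0 by (intro divide_left_mono) auto
      then have "1 / sqrt (1 + t / (a $ i)\<^sup>2) \<le> 1 / sqrt (1 + t / m)"
        using t m0 by (intro divide_left_mono) (auto intro!: mult_pos_pos add_pos_nonneg)
      also have "1 + t / (a $ i)\<^sup>2 = ((a $ i)\<^sup>2 + t) / (a $ i)\<^sup>2" using ai by (simp add: field_simps)
      finally show "a $ i / sqrt ((a $ i)\<^sup>2 + t) \<le> 1 / sqrt (1 + t / m)"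
        using ai by (simp add: real_sqrt_divide)
    qed
    also have "\<dots> = (1 / sqrt (1 + t / m)) ^ CARD('n)" by simp
    also have "\<dots> \<le> (1 / sqrt (1 + t / m)) ^ 3"
      using N t m0 by (intro power_decreasing) (auto simp: divide_le_eq_1 add_pos_nonneg)
    also have "\<dots> = (1 + t / m) powr (- 3 / 2)"
    proof -
      have "1 + t / m > 0" using t m0 by (simp add: add_pos_nonneg)
      then have "sqrt (1 + t / m) ^ 3 = (1 + t / m) powr (3 / 2)"
        by (simp add: powr_half_sqrt[symmetric] powr_power)
      then show ?thesis by (simp add: power_one_over powr_minus divide_simps)
    qed
    finally show ?thesis .
  qed
  have "(\<integral>\<^sup>+t. ennreal (indicator {0<..} t * gamma_prod a t) \<partial>lborel)
    \<le> (\<integral>\<^sup>+t. ennreal ((1 + t / m) powr (- 3 / 2)) * indicator {0..} t \<partial>lborel)"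
    using bound by (intro nn_integral_mono) (auto split: split_indicator intro!: ennreal_leI)
  also have "\<dots> = ennreal (0 - (- 2 * m * (1 + 0 / m) powr (- 1 / 2)))"
  proof (rule nn_integral_FTC_atLeast)
    fix t :: real assume t: "0 \<le> t"
    then have "1 + t / m > 0" using m0 by (simp add: add_pos_nonneg)
    moreover from this have "(1 + t / m) powr (- 3 / 2) = (1 + t / m) powr (- 1 / 2) / (1 + t / m)"
      using powr_diff[of "1 + t / m" "- 1 / 2" 1] by simp
    ultimately show "((\<lambda>t. - 2 * m * (1 + t / m) powr (- 1 / 2)) has_real_derivative (1 + t / m) powr (- 3 / 2)) (at t)"
      using m0 by (auto intro!: derivative_eq_intros simp del: distrib_left_numeral)
  next
    show "((\<lambda>t. - 2 * m * (1 + t / m) powr (- 1 / 2)) \<longlongrightarrow> 0) at_top"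
      using m0 by real_asymp
  qed auto
  also have "\<dots> < \<infinity>" by simp
  finally show ?thesis .
qed

section \<open>Passage from Gaussian densities to the indicator of the ellipsoid\<close>

text \<open>Both sides are integrals of one test function against \<open>M1\<close> and
  \<open>M2\<close>, whose equality follows from their moments. Finiteness is proved along with the
  identity because it comes from the finite mass of \<open>M1\<close>; it later yields the
  integrability of both integrands.\<close>

lemma nn_integral_newton_ellipsoid:
  fixes a x :: "real^'n::finite"
  assumes N: "CARD('n) \<ge> 3" and a: "\<And>i. a $ i > 0"
  defines "C \<equiv> pi powr (real CARD('n) / 2) / Gamma (real CARD('n) / 2 - 1)"
  shows "(\<integral>\<^sup>+y. ennreal (indicator (ellipsoid a) y * (1 / norm (x - y) ^ (CARD('n) - 2))) \<partial>lborel)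
      = (\<integral>\<^sup>+t. ennreal (indicator {0<..} t * (C * gamma_prod a t * max 0 (1 - ellipsoid_form a t x))) \<partial>lborel)"
      (is "?lhs = ?rhs")
    and "(\<integral>\<^sup>+y. ennreal (indicator (ellipsoid a) y * (1 / norm (x - y) ^ (CARD('n) - 2))) \<partial>lborel) < \<infinity>"
proof -
  have C: "C > 0" using N by (simp add: C_def Gamma_real_pos)
  define k where "k y = 1 / norm (x - y) ^ (CARD('n) - 2)" for y
  define q where "q = ellipsoid_form a 0"
  define Q where "Q t = ellipsoid_form a t x" for t
  define g where "g t = C * gamma_prod a t" for t
  have [measurable]: "k \<in> borel_measurable borel" "q \<in> borel_measurable borel"
    "Q \<in> borel_measurable borel" "g \<in> borel_measurable borel"
    unfolding k_def[abs_def] q_def Q_def[abs_def] g_def[abs_def] by measurable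
  have k: "k y \<ge> 0" and q: "q y \<ge> 0" for y by (simp_all add: k_def q_def ellipsoid_form_nonneg)
  have Q: "Q t \<ge> 0" and g: "g t \<ge> 0" if "t > 0" for t
    using that C a by (simp_all add: Q_def g_def ellipsoid_form_nonneg gamma_prod_nonneg)
  \<comment> \<open>Encodes the tail integral: for fixed \<open>t\<close>, a density integrated over
    \<open>s \<ge> Q t\<close> gives its tail function at \<open>Q t\<close>, so the right-hand side
    becomes an integral over pairs \<open>(t, s)\<close>. The factor \<open>exp (- s)\<close> is the
    damping that makes the mass finite.\<close>
  define w where "w t s = indicator {0<..} t * (if Q t \<le> s then g t * exp (- s) else 0)" for t s
  have [measurable]: "case_prod w \<in> borel_measurable (lborel \<Otimes>\<^sub>M lborel)"
    unfolding w_def[abs_def] by measurable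
  have w: "w t s \<ge> 0" for t s using g[of t] by (simp add: w_def split: split_indicator)
  \<comment> \<open>Push-forwards to \<open>[0,1]\<close> under \<open>u = exp (- q)\<close> and \<open>u = exp (- s)\<close>; the extra factor \<open>u\<close>
    makes both measures finite, and their moments are the Laplace transforms at \<open>n + 1\<close>.\<close>
  define M1 where "M1 = distr (density lborel (\<lambda>y. ennreal (k y * exp (- q y)))) borel (\<lambda>y. exp (- q y))"
  define M2 :: "real measure" where
    "M2 = distr (density (lborel \<Otimes>\<^sub>M lborel) (\<lambda>z. ennreal (case_prod w z))) borel (\<lambda>z. exp (- snd z))"
  have I1: "(\<integral>\<^sup>+u. h u \<partial>M1) = (\<integral>\<^sup>+y. ennreal (k y * exp (- q y)) * h (exp (- q y)) \<partial>lborel)"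
    if [measurable]: "h \<in> borel_measurable borel" for h
    unfolding M1_def by (simp add: nn_integral_distr nn_integral_density)
  have I2: "(\<integral>\<^sup>+u. h u \<partial>M2) = (\<integral>\<^sup>+t. \<integral>\<^sup>+s. ennreal (w t s) * h (exp (- s)) \<partial>lborel \<partial>lborel)"
    if [measurable]: "h \<in> borel_measurable borel" for h
    unfolding M2_def by (simp add: nn_integral_distr nn_integral_density lborel.nn_integral_fst[symmetric])
  have exp_tail: "(\<integral>\<^sup>+s. ennreal (b * exp (- (c * s))) * indicator {r..} s \<partial>lborel)
      = ennreal (b * exp (- (c * r)) / c)" if "b \<ge> 0" "c > 0" for b c r :: real
  proof -
    have "(\<integral>\<^sup>+s. ennreal (b * exp (- (c * s))) * indicator {r..} s \<partial>lborel)
      = ennreal (0 - (- (b * exp (- (c * r)) / c)))"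
    proof (rule nn_integral_FTC_atLeast)
      show "((\<lambda>s. - (b * exp (- (c * s)) / c)) \<longlongrightarrow> 0) at_top"
        using that by real_asymp
    qed (use that in \<open>auto intro!: derivative_eq_intros simp: field_simps\<close>)
    then show ?thesis by simp
  qed
  have tail: "(\<integral>\<^sup>+s. ennreal (w t s) * ennreal (exp (- s) ^ n) \<partial>lborel)
    = ennreal (indicator {0<..} t * (g t * exp (- (real (Suc n) * Q t)) / real (Suc n)))" for t n
  proof (cases "t > 0")
    case True
    have "(\<integral>\<^sup>+s. ennreal (w t s) * ennreal (exp (- s) ^ n) \<partial>lborel)
      = (\<integral>\<^sup>+s. ennreal (g t * exp (- (real (Suc n) * s))) * indicator {Q t..} s \<partial>lborel)"
      using True g[OF True]
      by (intro nn_integral_cong)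
        (auto simp: w_def ennreal_mult[symmetric] exp_of_nat_mult[symmetric] mult_exp_exp
          algebra_simps split: split_indicator)
    also have "\<dots> = ennreal (g t * exp (- (real (Suc n) * Q t)) / real (Suc n))"
      using exp_tail[OF g[OF True]] by simp
    finally show ?thesis using True by simp
  qed (simp add: w_def)
  have moments: "(\<integral>\<^sup>+u. ennreal (u ^ n) \<partial>M1) = (\<integral>\<^sup>+u. ennreal (u ^ n) \<partial>M2)" for n
  proof -
    have "(\<integral>\<^sup>+u. ennreal (u ^ n) \<partial>M1) = (\<integral>\<^sup>+y. ennreal (k y * exp (- (real (Suc n) * q y))) \<partial>lborel)"
      by (subst I1) (auto simp: k ennreal_mult[symmetric] exp_of_nat_mult[symmetric] mult_exp_exp
          algebra_simps intro!: nn_integral_cong)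
    \<comment> \<open>The Gaussian identity at \<open>l = Suc n\<close>, which is positive already
      for the moment of order 0.\<close>
    also have "\<dots> = (\<integral>\<^sup>+t. ennreal (indicator {0<..} t * (g t * exp (- (real (Suc n) * Q t)) / real (Suc n))) \<partial>lborel)"
      unfolding k_def q_def g_def Q_def C_def
      by (rule nn_integral_newton_gaussian[OF N a]) simp
    also have "\<dots> = (\<integral>\<^sup>+u. ennreal (u ^ n) \<partial>M2)"
      by (subst I2) (simp_all add: tail)
    finally show ?thesis .
  qed
  have fin: "emeasure M2 (space M2) < \<infinity>"
  proof -
    have "emeasure M2 (space M2) = (\<integral>\<^sup>+u. ennreal (u ^ 0) \<partial>M2)" by simp
    also have "\<dots> = (\<integral>\<^sup>+t. ennreal (indicator {0<..} t * (g t * exp (- Q t))) \<partial>lborel)"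
      using tail[of _ 0] by (subst I2) simp_all
    also have "\<dots> \<le> (\<integral>\<^sup>+t. ennreal C * ennreal (indicator {0<..} t * gamma_prod a t) \<partial>lborel)"
    proof (rule nn_integral_mono)
      fix t :: real
      show "ennreal (indicator {0<..} t * (g t * exp (- Q t))) \<le> ennreal C * ennreal (indicator {0<..} t * gamma_prod a t)"
      proof (cases "t > 0")
        case True
        then have "g t * exp (- Q t) \<le> g t" using Q g by (intro mult_left_le) auto
        then show ?thesis using True C by (simp add: g_def ennreal_mult'[symmetric] ennreal_leI)
      qed simp
    qed
    also have "\<dots> = ennreal C * (\<integral>\<^sup>+t. ennreal (indicator {0<..} t * gamma_prod a t) \<partial>lborel)"
      by (rule nn_integral_cmult) measurable
    also have "\<dots> < \<infinity>"
      using nn_integral_gamma_prod_finite[OF N a] by (simp add: ennreal_mult_less_top)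
    finally show ?thesis .
  qed
  \<comment> \<open>The moment of order 0 transfers finiteness from \<open>M2\<close> to
    \<open>M1\<close>; this controls the singularity of the Newton kernel.\<close>
  have fin1: "emeasure M1 (space M1) < \<infinity>" using fin moments[of 0] by simp
  have supp1: "AE u in M1. u \<in> {0..1}"
    unfolding M1_def using q by (subst AE_distr_iff) auto
  have supp2: "AE u in M2. u \<in> {0..1}"
    unfolding M2_def
  proof (subst AE_distr_iff)
    have "0 \<le> s" if "0 < w t s" for t s
      using that Q[of t] by (auto simp: w_def split: if_splits split_indicator_asm)
    then show "AE z in density (lborel \<Otimes>\<^sub>M lborel) (\<lambda>z. ennreal (case_prod w z)). exp (- snd z) \<in> {0..1}"
      by (subst AE_density) auto
  qed auto
  have "M1 = M2"
  proof (rule finite_measure_eqI_moments[OF _ _ _ _ supp1 supp2])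
    show "finite_measure M1" "finite_measure M2"
      using fin fin1 by (auto intro!: finite_measureI)
    show "(LINT u|M1. u ^ n) = (LINT u|M2. u ^ n)" for n
    proof -
      have "(LINT u|M1. u ^ n) = enn2real (\<integral>\<^sup>+u. ennreal (u ^ n) \<partial>M1)"
        by (intro integral_eq_nn_integral eventually_mono[OF supp1]) (simp_all add: M1_def)
      moreover have "(LINT u|M2. u ^ n) = enn2real (\<integral>\<^sup>+u. ennreal (u ^ n) \<partial>M2)"
        by (intro integral_eq_nn_integral eventually_mono[OF supp2]) (simp_all add: M2_def)
      ultimately show ?thesis using moments by simp
    qed
  qed (simp_all add: M1_def M2_def)
  \<comment> \<open>\<open>u * h u\<close> is the indicator of \<open>q \<le> 1\<close>.\<close>
  define h where "h u = ennreal (indicator {exp (- 1)..} u / u)" for u :: real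
  have [measurable]: "h \<in> borel_measurable borel" unfolding h_def[abs_def] by measurable
  have E: "y \<in> ellipsoid a \<longleftrightarrow> q y \<le> 1" for y by (simp add: ellipsoid_conv_form q_def)
  have h1: "(\<integral>\<^sup>+u. h u \<partial>M1) = ?lhs"
    by (subst I1) (auto simp: h_def E k k_def[symmetric] ennreal_mult[symmetric] split: split_indicator
        intro!: nn_integral_cong)
  also have "?lhs = (\<integral>\<^sup>+u. h u \<partial>M2)" using h1 \<open>M1 = M2\<close> by simp
  also have "\<dots> = ?rhs"
  proof (subst I2, measurable, rule nn_integral_cong)
    fix t :: real
    show "(\<integral>\<^sup>+s. ennreal (w t s) * h (exp (- s)) \<partial>lborel)
      = ennreal (indicator {0<..} t * (C * gamma_prod a t * max 0 (1 - ellipsoid_form a t x)))"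
    proof (cases "t > 0")
      case True
      \<comment> \<open>The factor \<open>1 / u\<close> in \<open>h\<close> cancels the damping
        \<open>exp (- s)\<close>. What remains is the length of \<open>{Q t..1}\<close>, an empty
        interval if \<open>Q t > 1\<close>; hence the truncation by \<open>max 0\<close>.\<close>
      have "(\<integral>\<^sup>+s. ennreal (w t s) * h (exp (- s)) \<partial>lborel)
        = (\<integral>\<^sup>+s. ennreal (g t) * indicator {Q t..1} s \<partial>lborel)"
        using True g[OF True]
        by (intro nn_integral_cong) (auto simp: w_def h_def ennreal_mult[symmetric] split: split_indicator)
      also have "\<dots> = ennreal (g t) * emeasure lborel {Q t..1}"
        by (rule nn_integral_cmult_indicator) simp
      also have "emeasure lborel {Q t..1} = ennreal (max 0 (1 - Q t))"
        by (cases "Q t \<le> 1") auto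
      finally show ?thesis using True g[OF True] by (simp add: ennreal_mult[symmetric] g_def Q_def)
    qed (simp add: w_def)
  qed
  finally show "?lhs = ?rhs" using h1 by simp
  have "?lhs = (\<integral>\<^sup>+u. h u \<partial>M1)" using h1 by simp
  also have "\<dots> \<le> (\<integral>\<^sup>+u. ennreal (exp 1) \<partial>M1)"
  proof (rule nn_integral_mono)
    fix u :: real
    show "h u \<le> ennreal (exp 1)"
    proof (cases "u \<ge> exp (- 1)")
      case True
      moreover have "0 < exp (- 1 :: real)" by simp
      ultimately have "0 < u" by linarith
      with True show ?thesis by (auto simp: h_def exp_minus field_simps intro!: ennreal_leI)
    qed (simp add: h_def)
  qed
  also have "\<dots> < \<infinity>" using fin1 by (simp add: ennreal_mult_less_top)
  finally show "?lhs < \<infinity>" .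
qed

section \<open>Boundaries of the confocal ellipsoids and the function \<open>tau\<close>\<close>

lemma ellipsoid_at_conv_form: "ellipsoid_at a t = {x. ellipsoid_form a t x \<le> 1}"
  by (simp add: ellipsoid_at_def A_mat_inner)

text \<open>The form is homogeneous of degree 2, so a point of an open subset of the ellipsoid can
  be moved slightly outward along its ray without leaving the ellipsoid; its form is then strictly
  below 1.\<close>

lemma frontier_ellipsoid_at: "frontier (ellipsoid_at a t) = {x. ellipsoid_form a t x = 1}"
proof -
  let ?S = "{x. ellipsoid_form a t x \<le> 1}"
  have "closed ?S"
    by (intro closed_Collect_le continuous_on_ellipsoid_form continuous_on_const)
  moreover have "interior ?S = {x. ellipsoid_form a t x < 1}"
  proof (rule interior_unique)
    show "open {x. ellipsoid_form a t x < 1}"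
      by (intro open_Collect_less continuous_on_ellipsoid_form continuous_on_const)
    fix T assume T: "T \<subseteq> ?S" "open T"
    show "T \<subseteq> {x. ellipsoid_form a t x < 1}"
    proof
      fix x assume "x \<in> T"
      have "\<forall>\<^sub>F d in at_right 0. (1 + d) *\<^sub>R x \<in> T"
      proof (rule topological_tendstoD)
        have "((\<lambda>d. (1 + d) *\<^sub>R x) \<longlongrightarrow> (1 + 0) *\<^sub>R x) (at_right 0)"
          by (intro tendsto_intros)
        then show "((\<lambda>d. (1 + d) *\<^sub>R x) \<longlongrightarrow> x) (at_right 0)" by simp
      qed (use T \<open>x \<in> T\<close> in auto)
      then have "\<forall>\<^sub>F d in at_right 0. (1 + d) *\<^sub>R x \<in> T \<and> d > (0::real)"
        by (intro eventually_conj eventually_at_right_less)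
      then obtain d :: real where d: "(1 + d) *\<^sub>R x \<in> T" "d > 0"
        using eventually_happens trivial_limit_at_right_real by blast
      have "ellipsoid_form a t ((1 + d) *\<^sub>R x) = (1 + d)\<^sup>2 * ellipsoid_form a t x"
        by (simp add: ellipsoid_form_def power_mult_distrib sum_distrib_left)
      then have "(1 + d)\<^sup>2 * ellipsoid_form a t x \<le> 1" using d T by auto
      moreover have "(1 + d)\<^sup>2 > 1" using d by simp
      ultimately show "x \<in> {x. ellipsoid_form a t x < 1}"
        by (smt (verit) mem_Collect_eq mult_le_cancel_left1)
    qed
  qed auto
  ultimately show ?thesis
    unfolding ellipsoid_at_conv_form frontier_def by auto
qed

lemma ellipsoid_form_antimono:
  assumes "\<And>i. a $ i > 0" "0 \<le> s" "s \<le> t"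
  shows "ellipsoid_form a t x \<le> ellipsoid_form a s x"
  unfolding ellipsoid_form_def using assms(1)[THEN less_imp_neq] assms
  by (intro sum_mono divide_left_mono) (auto intro!: mult_pos_pos add_pos_nonneg)

lemma ellipsoid_form_strict_antimono:
  assumes a: "\<And>i. a $ i > 0" and st: "0 \<le> s" "s < t" and x: "x \<noteq> 0"
  shows "ellipsoid_form a t x < ellipsoid_form a s x"
proof -
  obtain j where "x $ j \<noteq> 0" using x by (metis vec_eq_iff zero_index)
  then show ?thesis
    unfolding ellipsoid_form_def using a[THEN less_imp_neq] a st
    by (intro sum_strict_mono_ex1)
      (auto intro!: divide_left_mono mult_pos_pos add_pos_nonneg bexI[of _ j] divide_strict_left_mono)
qed

text \<open>Locates the sign change of \<open>1 - ellipsoid_form a t x\<close>. Outside the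
  ellipsoid a root exists by the intermediate value theorem and is unique by strict monotonicity in
  \<open>t\<close>. The condition \<open>0 < t\<close> in the last claim matters inside the
  ellipsoid, where \<open>tau a x = 0\<close> but the form at 0 may be below 1.\<close>

lemma tau_props:
  assumes a: "\<And>i. a $ i > 0"
  shows "tau a x \<ge> 0"
    and "tau a x \<le> t \<Longrightarrow> ellipsoid_form a t x \<le> 1"
    and "0 < t \<Longrightarrow> t \<le> tau a x \<Longrightarrow> ellipsoid_form a t x \<ge> 1"
proof -
  have cl: "closure (ellipsoid a) = {x. ellipsoid_form a 0 x \<le> 1}"
    unfolding ellipsoid_conv_form
    by (intro closure_closed closed_Collect_le continuous_on_ellipsoid_form continuous_on_const)
  have "tau a x \<ge> 0 \<and> ellipsoid_form a (tau a x) x \<le> 1 \<and> (tau a x > 0 \<longrightarrow> ellipsoid_form a (tau a x) x = 1)"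
  proof (cases "ellipsoid_form a 0 x \<le> 1")
    case True
    then show ?thesis by (simp add: tau_def cl)
  next
    case False
    then have x0: "x \<noteq> 0" by (auto simp: ellipsoid_form_def)
    \<comment> \<open>The squared norm of \<open>x\<close> bounds the root from above: every
      denominator of the form at \<open>T\<close> is at least \<open>T\<close>, so the form there is
      at most 1.\<close>
    define T where "T = (\<Sum>i\<in>UNIV. (x $ i)\<^sup>2)"
    have T: "T > 0"
    proof -
      have "T = (norm x)\<^sup>2"
        by (simp only: power2_norm_eq_inner inner_vec_def T_def) (simp add: power2_eq_square)
      with x0 show ?thesis by simp
    qed
    have "ellipsoid_form a T x \<le> (\<Sum>i\<in>UNIV. (x $ i)\<^sup>2 / T)"
      unfolding ellipsoid_form_def using T
      by (intro sum_mono divide_left_mono) (auto intro!: mult_pos_pos add_nonneg_pos)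
    also have "\<dots> = 1" using T by (simp add: sum_divide_distrib[symmetric] T_def)
    finally have "\<exists>t\<ge>0. t \<le> T \<and> ellipsoid_form a t x = 1"
    proof (intro IVT2')
      have "(a $ i)\<^sup>2 + t \<noteq> 0" if "t \<in> {0..T}" for i t
        using that a[of i] by (metis atLeastAtMost_iff add_pos_nonneg less_irrefl zero_less_power)
      then show "continuous_on {0..T} (\<lambda>t. ellipsoid_form a t x)"
        unfolding ellipsoid_form_def by (intro continuous_intros) auto
    qed (use False T in auto)
    then obtain t where t: "t \<ge> 0" "ellipsoid_form a t x = 1" by blast
    have "(THE t. t \<ge> 0 \<and> x \<in> frontier (ellipsoid_at a t)) = t"
    proof (rule the_equality)
      show "0 \<le> t \<and> x \<in> frontier (ellipsoid_at a t)" using t by (simp add: frontier_ellipsoid_at)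
      fix s assume "0 \<le> s \<and> x \<in> frontier (ellipsoid_at a s)"
      then show "s = t"
        using ellipsoid_form_strict_antimono[OF a _ _ x0] t
        by (metis (mono_tags, lifting) frontier_ellipsoid_at less_irrefl linorder_neqE_linordered_idom mem_Collect_eq)
    qed
    with t False show ?thesis by (simp add: tau_def cl)
  qed
  then show "tau a x \<ge> 0"
    and "tau a x \<le> t \<Longrightarrow> ellipsoid_form a t x \<le> 1"
    and "0 < t \<Longrightarrow> t \<le> tau a x \<Longrightarrow> ellipsoid_form a t x \<ge> 1"
    using ellipsoid_form_antimono[OF a, of "tau a x" t x] ellipsoid_form_antimono[OF a, of t "tau a x" x]
    by auto
qed

section \<open>The normalizing constant and the final formula\<close>

text \<open>With N = 2p + 2, the sphere has area N pi^(p+1) / Gamma (p + 2), and Gamma (p + 2) = (p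
  + 1) p Gamma p. Hence (N - 2) times the area is 4 pi^(p+1) / Gamma p.\<close>

lemma newton_const_eq:
  assumes N: "CARD('n::finite) \<ge> 3"
  shows "newton_const TYPE('n) * (pi powr (real CARD('n) / 2) / Gamma (real CARD('n) / 2 - 1)) = 1 / 4"
proof -
  define p where "p = real CARD('n) / 2 - 1"
  have p: "p > 0" using N by (simp add: p_def)
  have "p \<notin> \<int>\<^sub>\<le>\<^sub>0" "p + 1 \<notin> \<int>\<^sub>\<le>\<^sub>0" using p by (auto elim!: nonpos_Ints_cases)
  then have "Gamma (p + 1 + 1) = (p + 1) * (p * Gamma p)"
    by (simp only: Gamma_plus1 not_False_eq_True)
  moreover have n: "real CARD('n) = 2 * p + 2" by (simp add: p_def)
  moreover have half: "(2 * p + 2) / 2 = p + 1" "2 * p + 2 - 2 = 2 * p" "p + 1 - 1 = p" by simp_all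
  ultimately have A: "newton_const TYPE('n) * (pi powr (real CARD('n) / 2) / Gamma (real CARD('n) / 2 - 1))
    = 1 / (2 * p * ((2 * p + 2) * (P / ((p + 1) * (p * G))))) * (P / G)"
    if "P = pi powr (p + 1)" "G = Gamma p" for P G
    unfolding that newton_const_def surface_area_unit_sphere unit_ball_vol_def DIM_cart DIM_real mult_1_right
    by (simp only: n half)
  have B: "1 / (2 * p * ((2 * p + 2) * (P / ((p + 1) * (p * G))))) * (P / G) = 1 / 4"
    if "P > 0" "G > 0" for P G :: real
  proof -
    have "2 * p * ((2 * p + 2) * (P / ((p + 1) * (p * G)))) = 4 * (P / G)"
      using p that by (simp add: divide_simps)
    with that show ?thesis by simp
  qed
  show ?thesis
    unfolding A[OF refl refl] by (rule B) (use Gamma_real_pos[OF p] in auto)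
qed

text \<open>The integrability claims ensure that neither integral is the default value 0 of the
  Bochner integral, so the equation relates genuine integrals.\<close>

theorem theorem2p1:
  fixes a x :: "real^'n::finite"
  assumes "CARD('n) \<ge> 3"
    and "\<And>i. a $ i > 0"
  shows "set_integrable lborel (ellipsoid a) (\<lambda>y. 1 / norm (x - y) ^ (CARD('n) - 2))
    \<and> set_integrable lborel {tau a x<..}
         (\<lambda>t. gamma_prod a t * (1 - (A_mat a t *v x) \<bullet> x))
    \<and> newtonian_potential (ellipsoid a) (indicator (ellipsoid a)) x
       = 1 / 4 * (LINT t:{tau a x<..}|lborel. gamma_prod a t * (1 - (A_mat a t *v x) \<bullet> x))"
proof -
  note N = assms(1) and a = assms(2)
  define C where "C = pi powr (real CARD('n) / 2) / Gamma (real CARD('n) / 2 - 1)"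
  have C: "C > 0" using N by (simp add: C_def Gamma_real_pos)
  define G where "G y = indicator (ellipsoid a) y * (1 / norm (x - y) ^ (CARD('n) - 2))" for y
  define F where "F t = indicator {tau a x<..} t * (gamma_prod a t * (1 - ellipsoid_form a t x))" for t
  have [measurable]: "ellipsoid a \<in> sets borel"
    unfolding ellipsoid_conv_form by measurable
  have [measurable]: "G \<in> borel_measurable borel" "F \<in> borel_measurable borel"
    unfolding G_def[abs_def] F_def[abs_def] by measurable
  have G: "G y \<ge> 0" for y by (simp add: G_def)
  note tau = tau_props[OF a, where x = x]
  have F: "F t \<ge> 0" for t
    using tau(1) tau(2)[of t] a by (auto simp: F_def gamma_prod_nonneg split: split_indicator)
  \<comment> \<open>On \<open>{0<..tau a x}\<close> the truncated factor vanishes and beyond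
    \<open>tau a x\<close> the truncation has no effect, so \<open>max 0\<close> amounts to the
    lower limit \<open>tau a x\<close>.\<close>
  have F_eq: "indicator {0<..} t * (C * gamma_prod a t * max 0 (1 - ellipsoid_form a t x)) = C * F t" for t
    using tau(1) tau(2)[of t] tau(3)[of t] by (auto simp: F_def max_def split: split_indicator)
  have nn: "(\<integral>\<^sup>+y. ennreal (G y) \<partial>lborel) = (\<integral>\<^sup>+t. ennreal (C * F t) \<partial>lborel)"
    using nn_integral_newton_ellipsoid(1)[OF N a, of x] unfolding G_def C_def[symmetric] F_eq .
  have fin: "(\<integral>\<^sup>+y. ennreal (G y) \<partial>lborel) < \<infinity>"
    using nn_integral_newton_ellipsoid(2)[OF N a, of x] unfolding G_def .
  have iG: "integrable lborel G"
    using fin G by (intro integrableI_nonneg) auto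
  have "integrable lborel (\<lambda>t. C * F t)"
    using fin F C by (intro integrableI_nonneg) (auto simp: nn)
  then have iF: "integrable lborel F" using C by simp
  have "(LINT y|lborel. G y) = (LINT t|lborel. C * F t)"
    using C F G by (subst (1 2) integral_eq_nn_integral) (auto simp: nn)
  then have eq: "(LINT y|lborel. G y) = C * (LINT t|lborel. F t)" by simp
  \<comment> \<open>The indicator occurs twice in the potential, as domain of integration and as
    density; the two collapse into one.\<close>
  have "newtonian_potential (ellipsoid a) (indicator (ellipsoid a)) x
    = newton_const TYPE('n) * (LINT y|lborel. G y)"
    unfolding newtonian_potential_def set_lebesgue_integral_def G_def
    by (intro arg_cong[where f="(*) _"] Bochner_Integration.integral_cong) (auto split: split_indicator)
  also have "\<dots> = 1 / 4 * (LINT t|lborel. F t)"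
    unfolding eq mult.assoc[symmetric] C_def newton_const_eq[OF N] ..
  finally show ?thesis
    using iG iF unfolding A_mat_inner set_integrable_def set_lebesgue_integral_def
    by (simp add: G_def[abs_def] F_def[abs_def])
qed

end
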